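(* Let $-\infty<L<R<\infty$ and let $p:\mathbb{R}\to[0,\infty)$ be a probability density function with support $[L,R]$ and distribution function $P$, satisfying the following conditions. (i) $p$ is continuous and positive on $(L,R)$, and there are finitely many points $L<y_1<\dots<y_m<R$ ($m\ge 0$) such that $p$ is continuously differentiable on each component interval of $S(p)=(L,R)\setminus\{y_1,\dots,y_m\}$. (ii) $\sup_{x\in S(p)}\left|\frac{p'(x)\min\{P(x),1-P(x)\}}{p^2(x)}\right|<\infty$. (iii) $\int_{S(p)}(1+|x|)\,|p'(x)|\,\mathrm{d}x<\infty$. (iv) $\lim_{x\searrow L}\frac{P(x)}{p(x)}=0$. (v) $\lim_{x\nearrow R}\frac{1-P(x)}{p(x)}=0$. Assume that the limit $\lim_{x\nearrow R}p(x)$ exists. Let $X:\Omega\to(L,R)$ be a random variable with $\mathbb{P}(X\in S(p))=1$ and $\mathbb{E}\left|\frac{p'(X)}{p(X)}\right|<\infty$. Then $X$ has Lebesgue density $p$ if, and only if, the distribution function $F_X$ of $X$ satisfies $$F_X(t)=\mathbb{E}\left[-\frac{p'(X)}{p(X)}\Big(\min\{X,t\}-L\Big)\right]+(t-L)\lim_{x\nearrow R}p(x),\quad L<t<R.$$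
   Context: $(\Omega,\mathcal{A},\mathbb{P})$ is a probability space. $F_X(t)=\mathbb{P}(X\le t)$ is the distribution function of $X$. "$X$ has Lebesgue density $p$" means that the law of $X$ is $p\,\mathcal{L}^1$, where $\mathcal{L}^1$ is Lebesgue measure on $\mathbb{R}$. $P(x)=\int_{L}^x p(s)\,\mathrm{d}s$ for $x\in[L,R]$. The case $m=0$ is allowed. "The limit exists" means that it exists as a (finite) real number. *)

theory Defs
  imports "HOL-Probability.Probability"
begin

definition smooth_points :: "real \<Rightarrow> real \<Rightarrow> real set \<Rightarrow> real set" where
  "smooth_points L R Y = {L<..<R} - Y"

(* Only used for x in [L, R], where L is the left end point of the support of p. *)
definition density_cdf :: "real \<Rightarrow> (real \<Rightarrow> real) \<Rightarrow> real \<Rightarrow> real" where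
  "density_cdf L p x = (LINT s:{L..x}|lborel. p s)"

end

theory Submission
  imports Defs
begin

text \<open>
Let \<open>N\<close> be the law of \<open>X\<close>, let \<open>h = p'/p\<close> on \<open>(L, R)\<close>, let \<open>l\<close> be the limit of \<open>p\<close> at \<open>R\<close>,
and put \<open>T s = E[h(X) 1(X > s)]\<close>. Since \<open>min(X, t) - L\<close> is the length of the set of all
\<open>s \<in> (L, t]\<close> with \<open>s < X\<close>, Fubini's theorem turns the right-hand side of the claimed formula into
the integral over \<open>(L, t]\<close> of \<open>g = l - T\<close>. So the formula says that \<open>g\<close> is a density of \<open>N\<close>
on \<open>(L, R)\<close>.

If \<open>p\<close> is the density of \<open>X\<close>, then \<open>T s\<close> is the integral of \<open>p'\<close> over \<open>(s, R)\<close>, which is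
\<open>l - p s\<close> by the fundamental theorem of calculus (\<open>tail_integral_log_derivative\<close>). Hence \<open>g = p\<close>,
and the formula holds.

Conversely, assume the formula. The distribution function \<open>F\<close> is an indefinite integral of the
bounded function \<open>g\<close>, hence continuous, so \<open>N\<close> has no atoms; therefore \<open>T\<close> and \<open>g\<close> are continuous
(\<open>isCont_tail_integral\<close>), and \<open>F' = g\<close>. On a short interval around a point \<open>x\<close> where \<open>h\<close> is
continuous, the increment of \<open>T\<close> is about \<open>- h x\<close> times the increment of \<open>F\<close>, so
\<open>T' = - h F'\<close> (\<open>has_real_derivative_tail_integral\<close>). Thus \<open>g' = h g\<close> outside finitely many points.
This is the linear differential equation that \<open>p\<close> satisfies, so \<open>g/p\<close> has derivative zero outside a
finite set; being continuous, it is a constant \<open>c\<close> (\<open>tail_integral_proportional\<close>). So \<open>F\<close> is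
\<open>c\<close> times the distribution function of \<open>p\<close>; both have the limit \<open>1\<close> at \<open>R\<close>, so \<open>c = 1\<close>
(\<open>real_distribution_eqI_proportional_cdf\<close>).

Deriving the differential equation from \<open>F\<close> rather than from a density of \<open>N\<close> avoids having to know
beforehand that \<open>g\<close> is nonnegative.
\<close>

section \<open>Derivatives of piecewise smooth functions\<close>

text \<open>
The components of an open set are open, so the derivatives supplied on each component are two-sided
and fit together to one continuous function.
\<close>

lemma C1_on_components_imp_deriv:
  fixes f :: "real \<Rightarrow> real"
  assumes S: "open S"
    and C1: "\<And>C. C \<in> components S \<Longrightarrow> f C1_differentiable_on C"
  shows "\<And>x. x \<in> S \<Longrightarrow> (f has_real_derivative deriv f x) (at x)"
    and "continuous_on S (deriv f)"
proof -
  have *: "(f has_real_derivative deriv f x) (at x) \<and> isCont (deriv f) x" if "x \<in> S" for x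
  proof -
    obtain C where C: "C \<in> components S" "x \<in> C"
      using \<open>x \<in> S\<close> Union_components by blast
    have "open C"
      using open_components[OF S] C by blast
    obtain D where D: "\<And>z. z \<in> C \<Longrightarrow> (f has_vector_derivative D z) (at z)" "continuous_on C D"
      using C1[OF C(1)] unfolding C1_differentiable_on_def by blast
    have eq: "deriv f z = D z" if "z \<in> C" for z
      using D(1)[OF that] by (intro DERIV_imp_deriv) (simp add: has_real_derivative_iff_has_vector_derivative)
    have "continuous_on C (deriv f)"
      using D(2) eq by (simp cong: continuous_on_cong)
    then show ?thesis
      using D(1)[OF C(2)] eq[OF C(2)] \<open>open C\<close> C(2)
      by (simp add: has_real_derivative_iff_has_vector_derivative continuous_on_eq_continuous_at)
  qed
  show "\<And>x. x \<in> S \<Longrightarrow> (f has_real_derivative deriv f x) (at x)"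
    using * by blast
  show "continuous_on S (deriv f)"
    using * by (simp add: continuous_at_imp_continuous_on)
qed

text \<open>
The fundamental theorem of calculus wants a function that is continuous on a closed interval.
Redefining \<open>p\<close> as its left limit at \<open>b\<close> achieves this without changing it inside.
\<close>

lemma FTC_Ioo_right_limit:
  fixes p p' :: "real \<Rightarrow> real"
  assumes "a < b" "finite Y"
    and cont: "continuous_on {a..<b} p"
    and lim: "(p \<longlongrightarrow> l) (at_left b)"
    and deriv: "\<And>x. x \<in> {a<..<b} - Y \<Longrightarrow> (p has_real_derivative p' x) (at x)"
    and int: "set_integrable lborel {a<..<b} p'"
  shows "(LINT x:{a<..<b}|lborel. p' x) = l - p a"
proof -
  define P where "P = (\<lambda>x. if x < b then p x else l)"
  have "continuous_on {a..b} P"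
    unfolding continuous_on_def
  proof
    fix x assume x: "x \<in> {a..b}"
    show "(P \<longlongrightarrow> P x) (at x within {a..b})"
    proof (cases "x < b")
      case True
      have "(p \<longlongrightarrow> p x) (at x within {a..<b})"
        using cont x True by (auto simp: continuous_on_def)
      also have "at x within {a..<b} = at x within {a..b}"
        using True by (intro at_within_nhd[where S="{..<b}"]) auto
      finally show ?thesis
        using True by (rule_tac Lim_transform_within_open[where s="{..<b}" and f=p])
          (auto simp: P_def)
    next
      case False
      then have [simp]: "x = b" using x by simp
      have "at b within {a..b} = at_left b"
        using \<open>a < b\<close> by (simp add: at_within_Icc_at_left)
      moreover have "(P \<longlongrightarrow> l) (at_left b)"
        using lim by (rule Lim_transform_eventually)
          (auto simp: P_def eventually_at_filter)
      ultimately show ?thesis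
        by (simp add: P_def)
    qed
  qed
  moreover have "(P has_vector_derivative p' x) (at x)" if "x \<in> {a<..<b} - Y" for x
    using deriv[OF that] that
    unfolding has_real_derivative_iff_has_vector_derivative
    by (rule_tac has_vector_derivative_transform_within_open[where S="{..<b}" and f=p])
      (auto simp: P_def)
  ultimately have "(p' has_integral (P b - P a)) {a..b}"
    using \<open>a < b\<close> \<open>finite Y\<close>
    by (intro fundamental_theorem_of_calculus_interior_strong) auto
  then have "integral {a<..<b} p' = l - p a"
    using \<open>a < b\<close> by (simp add: P_def integral_unique flip: integral_open_interval_real)
  then show ?thesis
    using set_borel_integral_eq_integral(2)[OF int] by simp
qed

section \<open>Tail integrals\<close>

definition tail_integral :: "real measure \<Rightarrow> (real \<Rightarrow> real) \<Rightarrow> real \<Rightarrow> real" where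
  "tail_integral N f s = (LINT x|N. f x * indicator {s<..} x)"

context finite_borel_measure
begin

lemma sets_eq_borel [measurable_cong, simp]: "sets M = sets borel"
  by (rule M_is_borel)

lemma integrable_mult_indicator_borel:
  fixes f :: "real \<Rightarrow> real"
  assumes "integrable M f" "A \<in> sets borel"
  shows "integrable M (\<lambda>x. f x * indicator A x)"
  using integrable_mult_indicator[OF _ assms(1), of A] assms(2) by (simp add: mult.commute)

text \<open>
For \<open>L \<le> x\<close>, the number \<open>min x t - L\<close> is the length of \<open>{L<..t} \<inter> {L<..<x}\<close>. Writing it as an integral
over \<open>s\<close> and exchanging the order of integration leaves, for each \<open>s\<close>, the integral of \<open>f\<close> over
\<open>x > s\<close>.
\<close>

lemma integral_truncation_eq_tail_integral:
  fixes f :: "real \<Rightarrow> real"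
  assumes f: "integrable M f" and L: "AE x in M. L \<le> x" and t: "L \<le> t"
  shows "set_integrable lborel {L<..t} (tail_integral M f)"
    and "(LINT x|M. f x * (min x t - L)) = (LINT s:{L<..t}|lborel. tail_integral M f s)"
proof -
  interpret pair_sigma_finite M lborel ..
  have [measurable]: "f \<in> borel_measurable M" using f by simp
  have [measurable]: "f \<in> borel_measurable borel"
    using f by (simp cong: measurable_cong_sets)
  define F :: "real \<times> real \<Rightarrow> real"
    where "F = (\<lambda>(x, s). f x * (indicator {L<..t} s * indicator {L<..<x} s))"
  have F_meas [measurable]: "F \<in> borel_measurable (M \<Otimes>\<^sub>M lborel)"
    unfolding F_def indicator_def greaterThanLessThan_iff by measurable
  have prod: "indicator {L<..t} s * indicator {L<..<x} s = (indicator ({L<..t} \<inter> {L<..<x}) s :: real)"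
    for x s :: real
    by (simp add: indicator_inter_arith)
  have len: "measure lborel ({L<..t} \<inter> {L<..<x}) = min x t - L" if "L \<le> x" for x
  proof (cases "x \<le> t")
    case True
    then have "{L<..t} \<inter> {L<..<x} = {L<..<x}" by auto
    then show ?thesis using True that by simp
  next
    case False
    then have "{L<..t} \<inter> {L<..<x} = {L<..t}" by auto
    then show ?thesis using False t by simp
  qed
  have fin: "emeasure lborel ({L<..t} \<inter> {L<..<x}) < \<infinity>" for x
  proof -
    have "emeasure lborel ({L<..t} \<inter> {L<..<x}) \<le> emeasure lborel {L<..t}"
      by (intro emeasure_mono) auto
    also have "\<dots> < \<infinity>"
      using t by simp
    finally show ?thesis .
  qed
  have int_ind: "integrable lborel (\<lambda>s. f x * indicator ({L<..t} \<inter> {L<..<x}) s)" for x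
    using fin by (intro integrable_mult_right integrable_real_indicator) auto
  have "integrable M (\<lambda>x. LINT s|lborel. norm (F (x, s)))"
  proof (rule Bochner_Integration.integrable_bound)
    show "integrable M (\<lambda>x. (t - L) * f x)"
      using f by simp
    show "(\<lambda>x. LINT s|lborel. norm (F (x, s))) \<in> borel_measurable M"
      by measurable
    show "AE x in M. norm (LINT s|lborel. norm (F (x, s))) \<le> norm ((t - L) * f x)"
      using L
    proof eventually_elim
      case (elim x)
      have "(LINT s|lborel. norm (F (x, s))) = \<bar>f x\<bar> * (min x t - L)"
        using elim t len[OF elim] by (simp add: F_def prod abs_mult)
      also have "\<dots> \<le> \<bar>f x\<bar> * (t - L)"
        by (intro mult_left_mono) auto
      finally show ?case
        using t by (simp add: abs_mult mult.commute)
    qed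
  qed
  then have intF: "integrable (M \<Otimes>\<^sub>M lborel) F"
    using int_ind by (intro Fubini_integrable F_meas) (auto simp: F_def prod)
  have tail: "(LINT x|M. F (x, s)) = indicator {L<..t} s * tail_integral M f s" for s
  proof -
    have "F (x, s) = indicator {L<..t} s * (f x * indicator {s<..} x)" for x
      by (auto simp: F_def indicator_def)
    then show ?thesis
      by (simp add: tail_integral_def)
  qed
  have "integrable lborel (\<lambda>s. LINT x|M. F (x, s))"
    using integrable_snd[of "\<lambda>x s. F (x, s)"] intF by simp
  then show "set_integrable lborel {L<..t} (tail_integral M f)"
    by (simp add: tail set_integrable_def)
  have "(LINT x|M. f x * (min x t - L)) = (LINT x|M. LINT s|lborel. F (x, s))"
  proof (rule integral_cong_AE)
    show "AE x in M. f x * (min x t - L) = (LINT s|lborel. F (x, s))"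
      using L by eventually_elim (simp add: F_def prod len)
  qed measurable
  also have "\<dots> = (LINT s|lborel. LINT x|M. F (x, s))"
    using Fubini_integral[of "\<lambda>x s. F (x, s)"] intF by simp
  finally show "(LINT x|M. f x * (min x t - L)) = (LINT s:{L<..t}|lborel. tail_integral M f s)"
    by (simp add: tail set_lebesgue_integral_def)
qed

text \<open>
Continuity of the distribution function at \<open>x\<close> means that \<open>x\<close> is not an atom; the integrands
then converge almost everywhere, dominated by \<open>\<bar>f\<bar>\<close>.
\<close>

lemma isCont_tail_integral:
  assumes f: "integrable M f" and x: "isCont (cdf M) x"
  shows "isCont (tail_integral M f) x"
proof -
  have [measurable]: "f \<in> borel_measurable borel"
    using f by (simp cong: measurable_cong_sets)
  have "measure M {x} = 0"
    using x isCont_cdf by simp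
  then have "AE z in M. z \<noteq> x"
    by (intro AE_I[where N="{x}"]) (auto simp: emeasure_eq_measure)
  have "(\<lambda>n. tail_integral M f (u n)) \<longlonglongrightarrow> tail_integral M f x" if u: "u \<longlonglongrightarrow> x" for u
    unfolding tail_integral_def
  proof (rule integral_dominated_convergence[where w="\<lambda>z. \<bar>f z\<bar>"])
    show "AE z in M. (\<lambda>n. f z * indicator {u n<..} z) \<longlonglongrightarrow> f z * indicator {x<..} z"
      using \<open>AE z in M. z \<noteq> x\<close>
    proof eventually_elim
      case (elim z)
      have "eventually (\<lambda>n. u n < z \<longleftrightarrow> x < z) sequentially"
      proof (cases "x < z")
        case True
        then show ?thesis using order_tendstoD(2)[OF u, of z] by simp
      next
        case False
        then have "z < x" using elim by simp
        from order_tendstoD(1)[OF u this] show ?thesis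
          by eventually_elim (use \<open>z < x\<close> in auto)
      qed
      then have "eventually (\<lambda>n. f z * indicator {x<..} z = f z * indicator {u n<..} z) sequentially"
        by eventually_elim (auto simp: indicator_def)
      then show ?case
        by (rule Lim_transform_eventually[OF tendsto_const])
    qed
  qed (use f in \<open>auto simp: indicator_def\<close>)
  then show ?thesis
    unfolding continuous_at_sequentially by (auto simp: o_def)
qed

lemma tail_integral_diff:
  assumes f: "integrable M f" and "x \<le> y"
  shows "tail_integral M f x - tail_integral M f y = (LINT z|M. f z * indicator {x<..y} z)"
proof -
  have "tail_integral M f x - tail_integral M f y
      = (LINT z|M. f z * indicator {x<..} z - f z * indicator {y<..} z)"
    unfolding tail_integral_def
    using integrable_mult_indicator_borel[OF f] by (intro Bochner_Integration.integral_diff[symmetric]) auto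
  also have "\<dots> = (LINT z|M. f z * indicator {x<..y} z)"
    using \<open>x \<le> y\<close> by (intro Bochner_Integration.integral_cong) (auto simp: indicator_def)
  finally show ?thesis .
qed

text \<open>
Where \<open>f\<close> is nearly the constant \<open>d\<close>, the tail integral changes nearly by \<open>d\<close> times the mass of the
interval. The error is measured in mass, not in length.
\<close>

lemma tail_integral_increment_bound:
  assumes f: "integrable M f" and "x \<le> y"
    and d: "\<And>z. z \<in> {x..y} \<Longrightarrow> \<bar>f z - d\<bar> \<le> e"
  shows "\<bar>tail_integral M f x - tail_integral M f y - d * (cdf M y - cdf M x)\<bar>
      \<le> e * (cdf M y - cdf M x)"
proof -
  have cdf: "cdf M y - cdf M x = (LINT z|M. indicator {x<..y} z)"
    using \<open>x \<le> y\<close> by (cases "x = y") (auto simp: cdf_diff_eq)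
  have int: "integrable M (\<lambda>z. f z * indicator {x<..y} z)"
    "integrable M (indicator {x<..y} :: real \<Rightarrow> real)"
    using integrable_mult_indicator_borel[OF f] by (auto simp: emeasure_eq_measure)
  have "tail_integral M f x - tail_integral M f y - d * (cdf M y - cdf M x)
      = (LINT z|M. f z * indicator {x<..y} z - d * indicator {x<..y} z)"
    using int by (simp add: tail_integral_diff[OF f \<open>x \<le> y\<close>] cdf)
  also have "\<bar>\<dots>\<bar> \<le> (LINT z|M. \<bar>f z * indicator {x<..y} z - d * indicator {x<..y} z\<bar>)"
    by (rule integral_abs_bound)
  also have "\<dots> \<le> (LINT z|M. e * indicator {x<..y} z)"
    by (intro integral_mono integrable_abs Bochner_Integration.integrable_diff integrable_mult_right int)
      (use d in \<open>auto simp: indicator_def\<close>)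
  also have "\<dots> = e * (cdf M y - cdf M x)"
    using int by (simp add: cdf)
  finally show ?thesis .
qed

text \<open>
This is the Stieltjes form of the fundamental theorem: the tail integral decreases by \<open>f dF\<close>, so its
derivative is \<open>- f F'\<close>. The error has two sources, the oscillation of \<open>f\<close> near \<open>x\<close> and the deviation
of \<open>F\<close> from its tangent, and each is given half of the tolerance \<open>e\<close>.
\<close>

lemma has_real_derivative_tail_integral:
  assumes f: "integrable M f" and cont: "isCont f x"
    and D: "(cdf M has_real_derivative D) (at x)"
  shows "(tail_integral M f has_real_derivative - (f x * D)) (at x)"
  unfolding has_field_derivative_def has_derivative_at_alt
proof (intro conjI allI impI)
  show "bounded_linear ((*) (- (f x * D)))"
    by (rule bounded_linear_mult_right)
next
  fix e :: real assume "0 < e"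
  \<comment> \<open>Near \<open>x\<close> an increment of \<open>F\<close> is at most \<open>(\<bar>D\<bar> + 1) \<bar>y - x\<bar>\<close>, which explains \<open>e1\<close>; the deviation
      from the tangent gets multiplied by \<open>\<bar>f x\<bar>\<close>, which explains \<open>e2\<close>. The added \<open>1\<close> keeps the
      divisors positive, and \<open>e2 \<le> 1\<close> is what the bound on the increment uses.\<close>
  define e1 where "e1 = e / 2 / (\<bar>D\<bar> + 1)"
  define e2 where "e2 = min 1 (e / 2 / (\<bar>f x\<bar> + 1))"
  have "e1 > 0" "e2 > 0"
    using \<open>0 < e\<close> by (auto simp: e1_def e2_def divide_pos_pos add_nonneg_pos)
  obtain d1 where d1: "d1 > 0" "\<And>z. \<bar>z - x\<bar> < d1 \<Longrightarrow> \<bar>f z - f x\<bar> < e1"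
    using cont \<open>e1 > 0\<close> unfolding continuous_at_eps_delta dist_real_def by blast
  obtain d2 where d2: "d2 > 0"
    "\<And>y. \<bar>y - x\<bar> < d2 \<Longrightarrow> \<bar>cdf M y - cdf M x - D * (y - x)\<bar> \<le> e2 * \<bar>y - x\<bar>"
    using D \<open>e2 > 0\<close> unfolding has_field_derivative_def has_derivative_at_alt real_norm_def by blast
  have "norm (tail_integral M f y - tail_integral M f x - - (f x * D) * (y - x)) \<le> e * norm (y - x)"
    if y: "\<bar>y - x\<bar> < min d1 d2" for y
  proof -
    define \<Delta> where "\<Delta> = cdf M y - cdf M x"
    have F: "\<bar>\<Delta> - D * (y - x)\<bar> \<le> e2 * \<bar>y - x\<bar>"
      using d2(2) y by (simp add: \<Delta>_def)
    have "\<bar>\<Delta>\<bar> \<le> \<bar>D * (y - x)\<bar> + e2 * \<bar>y - x\<bar>"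
      using F by linarith
    also have "\<dots> \<le> \<bar>D\<bar> * \<bar>y - x\<bar> + 1 * \<bar>y - x\<bar>"
      unfolding abs_mult by (intro add_mono mult_right_mono) (auto simp: e2_def)
    finally have \<Delta>: "\<bar>\<Delta>\<bar> \<le> (\<bar>D\<bar> + 1) * \<bar>y - x\<bar>"
      by (simp add: algebra_simps)
    have near: "\<bar>f z - f x\<bar> \<le> e1" if "z \<in> {min x y..max x y}" for z
      using d1(2)[of z] that y by (auto simp: min_def max_def split: if_splits)
    have "\<bar>tail_integral M f y - tail_integral M f x + f x * \<Delta>\<bar> \<le> e1 * \<bar>\<Delta>\<bar>"
    proof (cases "x \<le> y")
      case True
      then have "0 \<le> \<Delta>"
        using cdf_nondecreasing by (simp add: \<Delta>_def)
      with tail_integral_increment_bound[OF f True, of "f x" e1] near True show ?thesis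
        by (simp add: \<Delta>_def)
    next
      case False
      then have "\<Delta> \<le> 0" "y \<le> x"
        using cdf_nondecreasing by (simp_all add: \<Delta>_def)
      moreover have "f x * (cdf M x - cdf M y) = - (f x * \<Delta>)"
        by (simp add: \<Delta>_def algebra_simps)
      moreover have "cdf M x - cdf M y = \<bar>\<Delta>\<bar>"
        using \<open>\<Delta> \<le> 0\<close> by (simp add: \<Delta>_def)
      ultimately show ?thesis
        using tail_integral_increment_bound[OF f \<open>y \<le> x\<close>, of "f x" e1] near by simp
    qed
    also have "\<dots> \<le> e1 * (\<bar>D\<bar> + 1) * \<bar>y - x\<bar>"
      unfolding mult.assoc using \<Delta> \<open>e1 > 0\<close> by (intro mult_left_mono) auto
    also have "e1 * (\<bar>D\<bar> + 1) = e / 2"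
      using nonzero_mult_div_cancel_right[of "\<bar>D\<bar> + 1" "e / 2"]
      by (simp only: e1_def times_divide_eq_left)
    finally have 1: "\<bar>tail_integral M f y - tail_integral M f x + f x * \<Delta>\<bar> \<le> e / 2 * \<bar>y - x\<bar>" .
    have "\<bar>f x * (\<Delta> - D * (y - x))\<bar> \<le> (\<bar>f x\<bar> + 1) * (e / 2 / (\<bar>f x\<bar> + 1) * \<bar>y - x\<bar>)"
      unfolding abs_mult
    proof (rule mult_mono)
      have "e2 * \<bar>y - x\<bar> \<le> e / 2 / (\<bar>f x\<bar> + 1) * \<bar>y - x\<bar>"
        by (intro mult_right_mono) (auto simp: e2_def)
      then show "\<bar>\<Delta> - D * (y - x)\<bar> \<le> e / 2 / (\<bar>f x\<bar> + 1) * \<bar>y - x\<bar>"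
        using F by linarith
    qed auto
    also have "\<dots> = e / 2 / (\<bar>f x\<bar> + 1) * (\<bar>f x\<bar> + 1) * \<bar>y - x\<bar>"
      by (simp only: mult_ac)
    also have "e / 2 / (\<bar>f x\<bar> + 1) * (\<bar>f x\<bar> + 1) = e / 2"
      using nonzero_mult_div_cancel_right[of "\<bar>f x\<bar> + 1" "e / 2"]
      by (simp only: times_divide_eq_left)
    finally have 2: "\<bar>f x * \<Delta> - f x * D * (y - x)\<bar> \<le> e / 2 * \<bar>y - x\<bar>"
      by (simp add: algebra_simps)
    have "tail_integral M f y - tail_integral M f x - - (f x * D) * (y - x)
        = (tail_integral M f y - tail_integral M f x + f x * \<Delta>) - (f x * \<Delta> - f x * D * (y - x))"
      by simp
    also have "\<bar>\<dots>\<bar> \<le> e / 2 * \<bar>y - x\<bar> + e / 2 * \<bar>y - x\<bar>"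
      using 1 2 by linarith
    also have "\<dots> = e * \<bar>y - x\<bar>"
      by simp
    finally show ?thesis
      by (simp only: real_norm_def)
  qed
  then show "\<exists>d>0. \<forall>y. norm (y - x) < d \<longrightarrow>
      norm (tail_integral M f y - tail_integral M f x - - (f x * D) * (y - x)) \<le> e * norm (y - x)"
    using d1(1) d2(1) by (intro exI[of _ "min d1 d2"]) auto
qed

end

section \<open>Distributions concentrated on an interval\<close>

lemma (in real_distribution) cdf_concentrated_on_Ioo:
  assumes "measure M {L<..<R} = 1"
  shows "t \<le> L \<Longrightarrow> cdf M t = 0" and "R \<le> t \<Longrightarrow> cdf M t = 1"
    and "(cdf M \<longlongrightarrow> 1) (at_left R)"
proof -
  have disj: "measure M A = 0" if "A \<inter> {L<..<R} = {}" "A \<in> sets borel" for A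
  proof -
    have "measure M A + measure M {L<..<R} = measure M (A \<union> {L<..<R})"
      using that by (intro finite_measure_Union[symmetric]) auto
    also have "\<dots> \<le> 1"
      by simp
    finally show ?thesis
      using assms measure_nonneg[of M A] by linarith
  qed
  show "cdf M t = 0" if "t \<le> L"
    unfolding cdf_def2 using that by (intro disj) auto
  have one: "measure M A = 1" if "{L<..<R} \<subseteq> A" "A \<in> sets borel" for A
    using finite_measure_mono[OF that(1)] that(2) assms by (intro antisym) auto
  show "cdf M t = 1" if "R \<le> t"
    unfolding cdf_def2 using that by (intro one) auto
  have "measure M {..<R} = 1"
    by (intro one) auto
  then show "(cdf M \<longlongrightarrow> 1) (at_left R)"
    using cdf_at_left[of R] by simp
qed

text \<open>
Both distribution functions tend to \<open>1\<close> at \<open>R\<close>, which forces the factor to be \<open>1\<close>.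
\<close>

lemma real_distribution_eqI_proportional_cdf:
  assumes N1: "real_distribution N1" and N2: "real_distribution N2"
    and LR: "L < R"
    and c1: "measure N1 {L<..<R} = 1" and c2: "measure N2 {L<..<R} = 1"
    and proportional: "\<And>t. t \<in> {L<..<R} \<Longrightarrow> cdf N1 t = c * cdf N2 t"
  shows "N1 = N2"
proof -
  note F1 = real_distribution.cdf_concentrated_on_Ioo[OF N1 c1]
    and F2 = real_distribution.cdf_concentrated_on_Ioo[OF N2 c2]
  have "((\<lambda>t. c * cdf N2 t) \<longlongrightarrow> c * 1) (at_left R)"
    by (intro tendsto_intros F2(3))
  moreover have "eventually (\<lambda>t. c * cdf N2 t = cdf N1 t) (at_left R)"
    using eventually_at_left_real[OF LR] by eventually_elim (simp add: proportional)
  ultimately have "(cdf N1 \<longlongrightarrow> c * 1) (at_left R)"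
    by (rule Lim_transform_eventually)
  with F1(3) have "c = 1"
    using tendsto_unique[OF trivial_limit_at_left_real] by fastforce
  have "cdf N1 t = cdf N2 t" for t
    using F1(1,2)[of t] F2(1,2)[of t] proportional[of t] \<open>c = 1\<close>
    by (cases "t \<le> L"; cases "R \<le> t") auto
  then show ?thesis
    using cdf_unique[OF N1 N2] by blast
qed

section \<open>Tail integrals of the logarithmic derivative\<close>

text \<open>
Integration against the density \<open>p\<close> cancels the denominator of \<open>p'/p\<close>, and the fundamental theorem of
calculus evaluates what is left.
\<close>

lemma tail_integral_log_derivative:
  fixes p p' :: "real \<Rightarrow> real"
  assumes nonneg: "\<And>x. 0 \<le> p x" and [measurable]: "p \<in> borel_measurable borel"
    and pos: "\<And>x. x \<in> {L<..<R} \<Longrightarrow> 0 < p x"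
    and cont: "continuous_on {L<..<R} p"
    and lim: "(p \<longlongrightarrow> l) (at_left R)"
    and "finite Y"
    and deriv: "\<And>x. x \<in> {L<..<R} - Y \<Longrightarrow> (p has_real_derivative p' x) (at x)"
    and int: "set_integrable lborel {L<..<R} p'"
    and s: "s \<in> {L<..<R}"
  shows "tail_integral (density lborel p) (\<lambda>x. indicator {L<..<R} x * (p' x / p x)) s = l - p s"
proof -
  have [measurable]: "(\<lambda>x. indicator {L<..<R} x * p' x) \<in> borel_measurable borel"
    using int unfolding set_integrable_def by simp
  have [measurable]: "(\<lambda>x. indicator {L<..<R} x * (p' x / p x)) \<in> borel_measurable borel"
  proof -
    have "(\<lambda>x. indicator {L<..<R} x * p' x / p x) \<in> borel_measurable borel"
      by measurable
    then show ?thesis by simp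
  qed
  have "tail_integral (density lborel p) (\<lambda>x. indicator {L<..<R} x * (p' x / p x)) s
      = (LINT x|lborel. p x * (indicator {L<..<R} x * (p' x / p x) * indicator {s<..} x))"
    unfolding tail_integral_def using nonneg by (subst integral_density) auto
  also have "\<dots> = (LINT x:{s<..<R}|lborel. p' x)"
    unfolding set_lebesgue_integral_def
  proof (intro Bochner_Integration.integral_cong refl)
    fix x
    show "p x * (indicator {L<..<R} x * (p' x / p x) * indicator {s<..} x) = indicator {s<..<R} x *\<^sub>R p' x"
      using s pos[of x] by (auto simp: indicator_def)
  qed
  also have "\<dots> = l - p s"
  proof (rule FTC_Ioo_right_limit)
    show "continuous_on {s..<R} p"
      using cont by (rule continuous_on_subset) (use s in auto)
    show "set_integrable lborel {s<..<R} p'"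
      using int by (rule set_integrable_subset) (use s in auto)
  qed (use s lim deriv \<open>finite Y\<close> in auto)
  finally show ?thesis .
qed

text \<open>
The function \<open>l - tail_integral N h\<close> is at the same time the derivative of the distribution function
and, up to sign and a constant, a tail integral of \<open>h\<close>; together these say that it solves the equation
\<open>g' = h g\<close>. The positive function \<open>p\<close> solves it too, and the quotient of two solutions is constant.
\<close>

lemma tail_integral_proportional:
  fixes p h :: "real \<Rightarrow> real"
  assumes N: "finite_borel_measure N" and h: "integrable N h"
    and pos: "\<And>x. x \<in> {L<..<R} \<Longrightarrow> 0 < p x"
    and cont: "continuous_on {L<..<R} p"
    and "finite Y"
    and h_cont: "\<And>x. x \<in> {L<..<R} - Y \<Longrightarrow> isCont h x"
    and deriv: "\<And>x. x \<in> {L<..<R} - Y \<Longrightarrow> (p has_real_derivative h x * p x) (at x)"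
    and int: "\<And>t. t \<in> {L<..<R} \<Longrightarrow> set_integrable lborel {L<..t} (\<lambda>s. l - tail_integral N h s)"
    and cdf: "\<And>t. t \<in> {L<..<R} \<Longrightarrow> cdf N t = (LINT s:{L<..t}|lborel. l - tail_integral N h s)"
  obtains c where "\<And>s. s \<in> {L<..<R} \<Longrightarrow> l - tail_integral N h s = c * p s"
proof -
  interpret finite_borel_measure N by fact
  define g where "g = (\<lambda>s. l - tail_integral N h s)"
  have local: "\<exists>b\<in>{L<..<R}. x < b \<and> g integrable_on {L..b} \<and> (\<forall>t\<in>{L<..b}. cdf N t = integral {L..t} g)"
    if x: "x \<in> {L<..<R}" for x
  proof -
    have Ioc: "g integrable_on {L..t} \<and> cdf N t = integral {L..t} g" if t: "t \<in> {L<..<R}" for t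
    proof -
      have "(g has_integral cdf N t) {L<..t}"
        using set_borel_integral_eq_integral[OF int[OF t]] cdf[OF t]
        by (simp add: g_def has_integral_integral)
      moreover have "negligible {x \<in> {L<..t} - {L..t}. g x \<noteq> 0}"
        by (rule negligible_subset[of "{}"]) auto
      moreover have "negligible {x \<in> {L..t} - {L<..t}. g x \<noteq> 0}"
        by (rule negligible_subset[of "{L}"]) auto
      ultimately have "(g has_integral cdf N t) {L..t}"
        using has_integral_spike_set_eq by blast
      then show ?thesis by (auto simp: integral_unique)
    qed
    \<comment> \<open>Any point of \<open>(x, R)\<close> would do: it makes \<open>x\<close> interior to \<open>[L, b]\<close>.\<close>
    define b where "b = (x + R) / 2"
    have "b \<in> {L<..<R}" "x < b"
      using x by (auto simp: b_def)
    with Ioc show ?thesis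
      by (intro bexI[of _ b]) auto
  qed
  have at_x: "at x within {L..b} = at x" if "x \<in> {L<..<R}" "x < b" for x b :: real
    using that by (intro at_within_interior) auto
  have cdf_cont: "isCont (cdf N) x" if x: "x \<in> {L<..<R}" for x
  proof -
    obtain b where b: "x < b" "g integrable_on {L..b}" "\<And>t. t \<in> {L<..b} \<Longrightarrow> cdf N t = integral {L..t} g"
      using local[OF x] by blast
    have "continuous_on {L<..<b} (cdf N)"
    proof (rule continuous_on_eq)
      show "continuous_on {L<..<b} (\<lambda>t. integral {L..t} g)"
        using indefinite_integral_continuous_1[OF b(2)] by (rule continuous_on_subset) auto
    qed (use b(3) in auto)
    then show ?thesis
      using x b(1) by (simp add: continuous_on_eq_continuous_at)
  qed
  have g_cont: "isCont g x" if "x \<in> {L<..<R}" for x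
    unfolding g_def using isCont_tail_integral[OF h cdf_cont[OF that]] by (intro continuous_intros)
  have cdf_deriv: "(cdf N has_real_derivative g x) (at x)" if x: "x \<in> {L<..<R}" for x
  proof -
    obtain b where b: "x < b" "g integrable_on {L..b}" "\<And>t. t \<in> {L<..b} \<Longrightarrow> cdf N t = integral {L..t} g"
      using local[OF x] by blast
    have "((\<lambda>u. integral {L..u} g) has_vector_derivative g x) (at x within ({L..b} - {}))"
      using x b g_cont[OF x]
      by (intro integral_has_vector_derivative_continuous_at) (auto intro: continuous_at_imp_continuous_at_within)
    then have "((\<lambda>u. integral {L..u} g) has_real_derivative g x) (at x)"
      using at_x[OF x b(1)] by (simp add: has_real_derivative_iff_has_vector_derivative)
    then show ?thesis
      by (rule has_field_derivative_transform_within_open[of _ _ _ "{L<..<b}"]) (use x b in auto)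
  qed
  have g_deriv: "(g has_real_derivative h x * g x) (at x)" if x: "x \<in> {L<..<R} - Y" for x
    unfolding g_def
    using has_real_derivative_tail_integral[OF h h_cont[OF x] cdf_deriv] x
    by (auto intro!: derivative_eq_intros simp: g_def)
  define q where "q = (\<lambda>s. g s / p s)"
  have q_deriv: "(q has_derivative (\<lambda>_. 0)) (at x within {L<..<R})" if x: "x \<in> {L<..<R} - Y" for x
  proof -
    have "p x \<noteq> 0" using pos x by force
    have "(q has_real_derivative (h x * g x * p x - g x * (h x * p x)) / (p x * p x)) (at x)"
      unfolding q_def by (rule DERIV_divide[OF g_deriv[OF x] deriv[OF x] \<open>p x \<noteq> 0\<close>])
    then have "(q has_real_derivative 0) (at x)"
      by (simp add: mult_ac)
    then have "(q has_derivative (\<lambda>_. 0)) (at x)"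
      by (simp add: has_field_derivative_def lambda_zero)
    then show ?thesis
      by (rule has_derivative_at_withinI)
  qed
  have q_cont: "continuous_on {L<..<R} q"
    unfolding q_def
  proof (intro continuous_on_divide cont)
    show "continuous_on {L<..<R} g"
      using g_cont by (simp add: continuous_at_imp_continuous_on)
    show "\<forall>s\<in>{L<..<R}. p s \<noteq> 0"
      using pos by fastforce
  qed
  show thesis
  proof (cases "L < R")
    case True
    define m where "m = (L + R) / 2"
    have m: "m \<in> {L<..<R}" using True by (auto simp: m_def)
    have q_const: "q s = q m" if "s \<in> {L<..<R}" for s
      by (rule has_derivative_zero_unique_strong_convex[OF _ \<open>finite Y\<close> q_cont m refl q_deriv that]) simp_all
    have "g s = q m * p s" if "s \<in> {L<..<R}" for s
      unfolding q_const[OF that, symmetric] using pos[OF that] by (simp add: q_def)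
    then show thesis
      using that[of "q m"] by (simp add: g_def)
  next
    case False
    then show thesis using that by auto
  qed
qed

section \<open>The characterization\<close>

text \<open>
The characterization for laws on the real line. The factor \<open>indicator {L<..<R} x\<close> in \<open>h\<close> discards the
values of \<open>p'/p\<close> outside the interval, which \<open>N\<close> does not see, and makes \<open>h\<close> Borel measurable.
\<close>

lemma stein_characterization_real_distribution:
  fixes p p' :: "real \<Rightarrow> real" and N :: "real measure" and L R l :: real
  defines "h \<equiv> (\<lambda>x. indicator {L<..<R} x * (p' x / p x))"
  assumes LR: "L < R"
    and nonneg: "\<And>x. 0 \<le> p x" and p_density: "has_bochner_integral lborel p 1"
    and null: "\<And>x. x \<notin> {L..R} \<Longrightarrow> p x = 0"
    and pos: "\<And>x. x \<in> {L<..<R} \<Longrightarrow> 0 < p x"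
    and cont: "continuous_on {L<..<R} p"
    and lim: "(p \<longlongrightarrow> l) (at_left R)"
    and "finite Y"
    and deriv: "\<And>x. x \<in> {L<..<R} - Y \<Longrightarrow> (p has_real_derivative p' x) (at x)"
    and deriv_cont: "continuous_on ({L<..<R} - Y) p'"
    and int: "set_integrable lborel {L<..<R} p'"
    and N: "real_distribution N" and N_Ioo: "measure N {L<..<R} = 1"
    and h_int: "integrable N h"
  shows "N = density lborel p \<longleftrightarrow>
    (\<forall>t\<in>{L<..<R}. cdf N t = (LINT x|N. - h x * (min x t - L)) + (t - L) * l)"
proof -
  interpret N: real_distribution N by fact
  have [measurable]: "p \<in> borel_measurable borel"
    using borel_measurable_has_bochner_integral[OF p_density] by simp
  define P where "P = density lborel p"
  have P_sets: "sets P = sets borel"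
    by (simp add: P_def)
  have P_measure: "measure P A = (LINT x:A|lborel. p x)" if "A \<in> sets borel" for A
  proof -
    have "emeasure P A = (\<integral>\<^sup>+ x. ennreal (indicator A x * p x) \<partial>lborel)"
      unfolding P_def using that
      by (subst emeasure_density) (auto intro!: nn_integral_cong split: split_indicator)
    also have "\<dots> = ennreal (LINT x|lborel. indicator A x * p x)"
    proof (rule nn_integral_eq_integral)
      show "integrable lborel (\<lambda>x. indicator A x * p x)"
        using integrable_mult_indicator[of A lborel p] that p_density
        by (simp add: has_bochner_integral_iff)
    qed (simp add: nonneg)
    finally show ?thesis
      using nonneg by (simp add: measure_def set_lebesgue_integral_def)
  qed
  have ae: "AE x in lborel. x \<noteq> L \<and> x \<noteq> R"
    by (intro AE_conjI AE_lborel_singleton)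
  have P_Ioo: "measure P {L<..<R} = 1" and P_UNIV: "measure P UNIV = 1"
    and P_Iic: "cdf P t = (LINT x:{L<..t}|lborel. p x)" for t
  proof -
    have 1: "(LINT x|lborel. p x) = 1"
      using p_density by (simp add: has_bochner_integral_iff)
    show "measure P UNIV = 1"
      using 1 by (simp add: P_measure set_lebesgue_integral_def)
    have "(LINT x:{L<..<R}|lborel. p x) = (LINT x|lborel. p x)"
      unfolding set_lebesgue_integral_def
    proof (rule integral_cong_AE)
      show "AE x in lborel. indicator {L<..<R} x *\<^sub>R p x = p x"
        using ae by eventually_elim (auto simp: indicator_def not_less intro!: null)
    qed measurable
    then show "measure P {L<..<R} = 1"
      using 1 by (simp add: P_measure)
    have "(LINT x:{..t}|lborel. p x) = (LINT x:{L<..t}|lborel. p x)"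
      unfolding set_lebesgue_integral_def
    proof (rule integral_cong_AE)
      show "AE x in lborel. indicator {..t} x *\<^sub>R p x = indicator {L<..t} x *\<^sub>R p x"
        using ae by eventually_elim (auto simp: indicator_def not_less intro!: null)
    qed measurable
    then show "cdf P t = (LINT x:{L<..t}|lborel. p x)"
      by (simp add: cdf_def2 P_measure)
  qed
  have P: "real_distribution P"
  proof -
    have "emeasure P UNIV \<noteq> \<infinity>"
      using P_UNIV by (auto simp: measure_def)
    then have "emeasure P (space P) = 1"
      using P_UNIV by (simp add: emeasure_eq_ennreal_measure P_def)
    then show ?thesis
      by (intro real_distribution.intro real_distribution_axioms.intro prob_spaceI) (auto simp: P_sets)
  qed
  have AE_L: "AE x in N. L \<le> x"
    using N.AE_prob_1[OF N_Ioo] by eventually_elim simp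
  define T where "T = tail_integral N h"
  have T_int: "set_integrable lborel {L<..t} T"
    and T_eq: "(LINT x|N. h x * (min x t - L)) = (LINT s:{L<..t}|lborel. T s)"
    if "t \<in> {L<..<R}" for t
    using N.integral_truncation_eq_tail_integral[OF h_int AE_L, of t] that
    by (auto simp: T_def)
  have const_int: "set_integrable lborel {L<..t} (\<lambda>_. l)" if "t \<in> {L<..<R}" for t
    unfolding set_integrable_def using that
    by (intro integrable_scaleR_left integrable_real_indicator) auto
  have diff_int: "set_integrable lborel {L<..t} (\<lambda>s. l - T s)" if "t \<in> {L<..<R}" for t
    using const_int[OF that] T_int[OF that] by (rule set_integral_diff(1))
  have rhs: "(LINT x|N. - h x * (min x t - L)) + (t - L) * l = (LINT s:{L<..t}|lborel. l - T s)"
    if t: "t \<in> {L<..<R}" for t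
  proof -
    have "(LINT s:{L<..t}|lborel. l - T s) = (LINT s:{L<..t}|lborel. l) - (LINT s:{L<..t}|lborel. T s)"
      using const_int[OF t] T_int[OF t] by (rule set_integral_diff(2))
    also have "(LINT s:{L<..t}|lborel. l) = (t - L) * l"
      using t by (simp add: set_lebesgue_integral_def)
    finally show ?thesis
      using T_eq[OF t] by simp
  qed
  show ?thesis
  proof
    assume eq: "N = density lborel p"
    have T: "T s = l - p s" if "s \<in> {L<..<R}" for s
      unfolding T_def eq h_def
      by (rule tail_integral_log_derivative[OF nonneg _ pos cont lim \<open>finite Y\<close> deriv int that]) simp_all
    show "\<forall>t\<in>{L<..<R}. cdf N t = (LINT x|N. - h x * (min x t - L)) + (t - L) * l"
    proof
      fix t assume t: "t \<in> {L<..<R}"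
      have "(LINT s:{L<..t}|lborel. l - T s) = (LINT s:{L<..t}|lborel. p s)"
        using t T by (intro set_lebesgue_integral_cong) auto
      then show "cdf N t = (LINT x|N. - h x * (min x t - L)) + (t - L) * l"
        using P_Iic[of t] rhs[OF t] by (simp add: eq P_def)
    qed
  next
    assume formula: "\<forall>t\<in>{L<..<R}. cdf N t = (LINT x|N. - h x * (min x t - L)) + (t - L) * l"
    have h_cont: "isCont h x" if x: "x \<in> {L<..<R} - Y" for x
    proof -
      have "open ({L<..<R} - Y)"
        using \<open>finite Y\<close> by (intro open_Diff finite_imp_closed) auto
      moreover have "continuous_on ({L<..<R} - Y) h"
      proof -
        have "continuous_on ({L<..<R} - Y) (\<lambda>x. p' x / p x)"
        proof (intro continuous_on_divide deriv_cont)
          show "continuous_on ({L<..<R} - Y) p"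
            using cont by (rule continuous_on_subset) auto
          show "\<forall>x\<in>{L<..<R} - Y. p x \<noteq> 0"
            using pos by fastforce
        qed
        then show ?thesis
          by (rule continuous_on_eq) (simp add: h_def)
      qed
      ultimately show ?thesis
        using x by (simp add: continuous_on_eq_continuous_at)
    qed
    have h_deriv: "(p has_real_derivative h x * p x) (at x)" if "x \<in> {L<..<R} - Y" for x
      using deriv[OF that] that pos[of x] by (simp add: h_def)
    have cdf_N: "cdf N t = (LINT s:{L<..t}|lborel. l - T s)" if "t \<in> {L<..<R}" for t
      using formula that rhs by simp
    obtain c where c: "\<And>s. s \<in> {L<..<R} \<Longrightarrow> l - T s = c * p s"
      using tail_integral_proportional[OF N.finite_borel_measure_M h_int pos cont \<open>finite Y\<close>
          h_cont h_deriv diff_int[unfolded T_def] cdf_N[unfolded T_def]]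
      unfolding T_def by blast
    have "cdf N t = c * cdf P t" if t: "t \<in> {L<..<R}" for t
    proof -
      have "cdf N t = (LINT s:{L<..t}|lborel. l - T s)"
        by (rule cdf_N[OF t])
      also have "\<dots> = (LINT s:{L<..t}|lborel. c * p s)"
        using t c by (intro set_lebesgue_integral_cong) auto
      finally show ?thesis
        by (simp add: P_Iic)
    qed
    then show "N = density lborel p"
      using real_distribution_eqI_proportional_cdf[OF N P LR N_Ioo P_Ioo] unfolding P_def by blast
  qed
qed

theorem corollary6p5:
  fixes M :: "'a measure" and X :: "'a \<Rightarrow> real"
    and L R pR :: real and p :: "real \<Rightarrow> real" and Y :: "real set"
  assumes LR: "L < R"
    and p_nonneg: "\<And>x. 0 \<le> p x"
    and p_density: "has_bochner_integral lborel p 1"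
    and p_support: "closure {x. 0 < p x} = {L..R}"
    and p_cont: "continuous_on {L<..<R} p"
    and p_pos: "\<And>x. x \<in> {L<..<R} \<Longrightarrow> 0 < p x"
    and Y: "finite Y" "Y \<subseteq> {L<..<R}"
    and p_C1: "\<And>C. C \<in> components (smooth_points L R Y) \<Longrightarrow> p C1_differentiable_on C"
    and cond_ii: "bdd_above ((\<lambda>x. \<bar>deriv p x * min (density_cdf L p x) (1 - density_cdf L p x) / (p x)\<^sup>2\<bar>)
                    ` smooth_points L R Y)"
    and cond_iii: "set_integrable lborel (smooth_points L R Y) (\<lambda>x. (1 + \<bar>x\<bar>) * \<bar>deriv p x\<bar>)"
    and cond_iv: "((\<lambda>x. density_cdf L p x / p x) \<longlongrightarrow> 0) (at_right L)"
    and cond_v: "((\<lambda>x. (1 - density_cdf L p x) / p x) \<longlongrightarrow> 0) (at_left R)"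
    and p_lim: "(p \<longlongrightarrow> pR) (at_left R)"
    and M: "prob_space M"
    and X_rv: "X \<in> borel_measurable M"
    and X_range: "\<And>\<omega>. \<omega> \<in> space M \<Longrightarrow> X \<omega> \<in> {L<..<R}"
    and X_smooth: "measure M {\<omega> \<in> space M. X \<omega> \<in> smooth_points L R Y} = 1"
    and X_int: "integrable M (\<lambda>\<omega>. \<bar>deriv p (X \<omega>) / p (X \<omega>)\<bar>)"
  shows "distributed M lborel X (\<lambda>x. ennreal (p x)) \<longleftrightarrow>
    (\<forall>t\<in>{L<..<R}. measure M {\<omega> \<in> space M. X \<omega> \<le> t} =
       (LINT \<omega>|M. - (deriv p (X \<omega>) / p (X \<omega>)) * (min (X \<omega>) t - L)) + (t - L) * pR)"
proof -
  interpret prob_space M by fact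
  define S where "S = smooth_points L R Y"
  define N where "N = distr M borel X"
  define h where "h = (\<lambda>x. indicator {L<..<R} x * (deriv p x / p x))"
  note [measurable] = X_rv
  have S: "S = {L<..<R} - Y" "open S"
    using Y by (auto simp: S_def smooth_points_def intro!: open_Diff finite_imp_closed)
  have p_borel [measurable]: "p \<in> borel_measurable borel"
    using borel_measurable_has_bochner_integral[OF p_density] by simp
  have p_deriv: "\<And>x. x \<in> S \<Longrightarrow> (p has_real_derivative deriv p x) (at x)"
    and p'_cont: "continuous_on S (deriv p)"
    using C1_on_components_imp_deriv[OF S(2)] p_C1 by (auto simp: S_def)
  have ind_S: "(\<lambda>x. indicator S x * deriv p x) \<in> borel_measurable borel"
    using borel_measurable_continuous_on_indicator[OF _ p'_cont] S(2) by simp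
  \<comment> \<open>At the finitely many points of \<open>Y\<close> the value of \<open>deriv p\<close> is arbitrary. It cannot be dropped, as \<open>M\<close>
      need not be complete and the expectation in the claim contains it, but altering a function on a
      finite set keeps it measurable.\<close>
  have ind: "(\<lambda>x. indicator {L<..<R} x * deriv p x) \<in> borel_measurable borel"
    by (rule measurable_discrete_difference[OF ind_S, where X=Y])
      (use Y in \<open>auto simp: S indicator_def intro: countable_finite\<close>)
  have "integrable lborel (\<lambda>x. indicator S x * deriv p x)"
  proof (rule Bochner_Integration.integrable_bound)
    show "integrable lborel (\<lambda>x. indicator S x *\<^sub>R ((1 + \<bar>x\<bar>) * \<bar>deriv p x\<bar>))"
      using cond_iii by (simp add: set_integrable_def S_def)
    have "\<bar>deriv p x\<bar> \<le> (1 + \<bar>x\<bar>) * \<bar>deriv p x\<bar>" for x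
      by (simp add: distrib_right)
    then show "AE x in lborel. norm (indicator S x * deriv p x)
        \<le> norm (indicator S x *\<^sub>R ((1 + \<bar>x\<bar>) * \<bar>deriv p x\<bar>))"
      by (intro always_eventually) (auto simp: indicator_def abs_mult)
  qed (use ind_S in simp)
  then have p'_int: "set_integrable lborel {L<..<R} (deriv p)"
    unfolding set_integrable_def
    by (subst integrable_discrete_difference[where X=Y and g="\<lambda>x. indicator S x * deriv p x"])
      (use Y in \<open>auto simp: S indicator_def intro: countable_finite\<close>)
  have h_borel [measurable]: "h \<in> borel_measurable borel"
  proof -
    have "(\<lambda>x. indicator {L<..<R} x * deriv p x / p x) \<in> borel_measurable borel"
      using ind by measurable
    then show ?thesis by (simp add: h_def)
  qed
  have hX: "h (X \<omega>) = deriv p (X \<omega>) / p (X \<omega>)" if "\<omega> \<in> space M" for \<omega>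
    using X_range[OF that] by (simp add: h_def)
  have "integrable M (\<lambda>\<omega>. \<bar>h (X \<omega>)\<bar>)"
    using X_int by (simp add: hX cong: Bochner_Integration.integrable_cong)
  then have "integrable M (\<lambda>\<omega>. h (X \<omega>))"
    by (subst (asm) integrable_abs_iff) auto
  then have h_int: "integrable N h"
    unfolding N_def by (subst integrable_distr_eq) auto
  have N_Ioo: "measure N {L<..<R} = 1"
  proof -
    have "X -` {L<..<R} \<inter> space M = space M"
      using X_range by auto
    then show ?thesis
      by (simp add: N_def measure_distr prob_space)
  qed
  have p_null: "p x = 0" if "x \<notin> {L..R}" for x
    using that p_support p_nonneg[of x] closure_subset[of "{x. 0 < p x}"] by force
  have dist: "distributed M lborel X (\<lambda>x. ennreal (p x)) \<longleftrightarrow> N = density lborel p"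
  proof -
    have "distr M lborel X = N"
      unfolding N_def by (rule distr_cong) auto
    then show ?thesis
      by (simp add: distributed_def)
  qed
  have cdf: "cdf N t = measure M {\<omega> \<in> space M. X \<omega> \<le> t}" for t
  proof -
    have "X -` {..t} \<inter> space M = {\<omega> \<in> space M. X \<omega> \<le> t}" by auto
    then show ?thesis by (simp add: N_def cdf_def2 measure_distr)
  qed
  have E: "(LINT x|N. - h x * (min x t - L))
      = (LINT \<omega>|M. - (deriv p (X \<omega>) / p (X \<omega>)) * (min (X \<omega>) t - L))" for t
  proof -
    have "(LINT x|N. - h x * (min x t - L)) = (LINT \<omega>|M. - h (X \<omega>) * (min (X \<omega>) t - L))"
      unfolding N_def by (subst integral_distr) auto
    also have "\<dots> = (LINT \<omega>|M. - (deriv p (X \<omega>) / p (X \<omega>)) * (min (X \<omega>) t - L))"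
      by (intro Bochner_Integration.integral_cong) (auto simp: hX)
    finally show ?thesis .
  qed
  have N: "real_distribution N"
    unfolding N_def by simp
  have "N = density lborel p \<longleftrightarrow>
      (\<forall>t\<in>{L<..<R}. cdf N t = (LINT x|N. - h x * (min x t - L)) + (t - L) * pR)"
    unfolding h_def
    by (rule stein_characterization_real_distribution[OF LR p_nonneg p_density p_null p_pos p_cont p_lim
          Y(1) p_deriv[unfolded S] p'_cont[unfolded S] p'_int N N_Ioo h_int[unfolded h_def]])
  then show ?thesis
    unfolding dist E cdf .
qed

end
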